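(* Let $G$ be a finite group of order $n$. For every divisor $k$ of $n$ let $L_k(G)=\{x\in G : x^k=1\}$ and $f(k)=|L_k(G)|/k$. Let $g^{r,s}_{k,\,n/k}\in\mathbb{R}$ (for $r,s\in\mathbb{R}$ and $k$ a divisor of $n$) be the non-negative coefficients in the function $$T_G(r,s)=\sum_{k\mid n} g^{r,s}_{k,\,n/k}\; k\,\bigl(f(k)-1\bigr).$$ If $(r,s)\in\mathbb{R}^2$ satisfies $$1\le g^{r,s}_{k,\,n/k}\qquad\text{and}\qquad f(k)\le \bigl(g^{r,s}_{k,\,n/k}\bigr)^{-\frac12}\le k$$ for all divisors $k$ of $n$, then $T_G(r,s)=0$ and $G$ is solvable.
   Context: All groups are finite. For a finite group $G$ of order $n$ and a positive divisor $k$ of $n$, $L_k(G)=\{x\in G : x^k=1\}$. By a theorem of Frobenius, $k$ divides $|L_k(G)|$, so $f(k)=|L_k(G)|/k$ is an integer $\ge 1$, depending only on $k$ and $G$. The numbers $g^{r,s}_{k,\,n/k}$ are non-negative real coefficients depending only on $r,s\in\mathbb{R}$, on $n$ and on the divisor $k$ of $n$ (not otherwise on $G$). They are treated here as a given family of non-negative real numbers, and $T_G(r,s)$ is defined from them by the formula in the claim, the sum being over all positive divisors $k$ of $n$. *)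

theory Defs
  imports Complex_Main "HOL-Algebra.Algebra"
begin

definition frob_L :: "('a, 'b) monoid_scheme \<Rightarrow> nat \<Rightarrow> 'a set" where
  "frob_L G k = {x \<in> carrier G. x [^]\<^bsub>G\<^esub> k = \<one>\<^bsub>G\<^esub>}"

text \<open>
  For a finite group \<open>G\<close> and a divisor \<open>k\<close> of its order, this quotient is an integer by the
  theorem of Frobenius; the definition takes it in the reals and does not presuppose this.
\<close>

definition frob_f :: "('a, 'b) monoid_scheme \<Rightarrow> nat \<Rightarrow> real" where
  "frob_f G k = real (card (frob_L G k)) / real k"

text \<open>
  The coefficient with upper indices \<open>r, s\<close> and lower indices \<open>k, l\<close> is \<open>g r s k l\<close>. It is only
  used at complementary divisors, \<open>k dvd n\<close> and \<open>l = n div k\<close>, where the pair \<open>(k, l)\<close>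
  determines \<open>n\<close>.
\<close>

definition T_fun ::
  "(real \<Rightarrow> real \<Rightarrow> nat \<Rightarrow> nat \<Rightarrow> real) \<Rightarrow> ('a, 'b) monoid_scheme \<Rightarrow> real \<Rightarrow> real \<Rightarrow> real" where
  "T_fun g G r s =
     (\<Sum>k | k dvd order G. g r s k (order G div k) * real k * (frob_f G k - 1))"

end

theory Submission
  imports Defs
begin

text \<open>
  The hypothesis \<open>1 \<le> g\<close> makes \<open>g powr (- 1/2)\<close> at most \<open>1\<close>, so \<open>f(k) \<le> 1\<close>: the equation
  \<open>x\<^sup>k = 1\<close> has at most \<open>k\<close> solutions for every divisor \<open>k\<close> of the order \<open>n\<close>. This is the classical
  criterion for cyclicity, known from the multiplicative group of a finite field. If some \<open>a\<close>
  has order \<open>d\<close>, its \<open>d\<close> powers already exhaust the solutions of \<open>x\<^sup>d = 1\<close>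
  (\<open>frob_L_eq_powers\<close>), and only those with exponent coprime to \<open>d\<close> have order \<open>d\<close>; hence for
  each divisor \<open>d\<close> at most \<open>\<phi>(d)\<close> elements have order \<open>d\<close>. Both these numbers and the \<open>\<phi>(d)\<close> add up to
  \<open>n\<close> over the divisors \<open>d\<close> of \<open>n\<close>, so they agree for every \<open>d\<close>, and some element has order \<open>n\<close>
  (\<open>ex_ord_eq_order\<close>).

  Both conclusions follow from such a generator \<open>a\<close>. The group is abelian, hence solvable. For each
  \<open>k\<close> the element \<open>a\<^bsup>n/k\<^esup>\<close> has order \<open>k\<close>, so its powers are \<open>k\<close> solutions of \<open>x\<^sup>k = 1\<close>;
  with the upper bound, \<open>f(k) = 1\<close>, and every summand of \<open>T\<^sub>G(r,s)\<close> vanishes.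
\<close>

context group
begin

lemma powers_subset_frob_L:
  assumes "a \<in> carrier G"
  shows "(\<lambda>i::nat. a [^] i) ` {1..ord a} \<subseteq> frob_L G (ord a)"
proof -
  have "(a [^] i) [^] ord a = \<one>" for i :: nat
    using assms by (simp add: nat_pow_pow pow_eq_id)
  then show ?thesis
    using assms by (auto simp: frob_L_def)
qed

lemma card_powers:
  assumes "a \<in> carrier G"
  shows "card ((\<lambda>i::nat. a [^] i) ` {1..ord a}) = ord a"
  using ord_inj'[OF assms] by (simp add: card_image)

lemma finite_frob_L: "finite (carrier G) \<Longrightarrow> finite (frob_L G k)"
  by (simp add: frob_L_def)

lemma ord_le_card_frob_L:
  assumes "finite (carrier G)" and "a \<in> carrier G"
  shows "ord a \<le> card (frob_L G (ord a))"
  using card_mono[OF finite_frob_L powers_subset_frob_L] card_powers assms by metis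

lemma frob_L_eq_powers:
  assumes "finite (carrier G)" and "a \<in> carrier G"
    and "card (frob_L G (ord a)) \<le> ord a"
  shows "frob_L G (ord a) = (\<lambda>i::nat. a [^] i) ` {1..ord a}"
  using card_seteq[OF finite_frob_L powers_subset_frob_L] card_powers assms by metis

text \<open>
  Under the bound on the solutions of \<open>x\<^sup>d = 1\<close>, one element \<open>a\<close> of order \<open>d\<close> determines
  all others: they are the powers \<open>a\<^sup>i\<close> with \<open>i\<close> coprime to \<open>d\<close>. The inequality covers the
  case that no element has order \<open>d\<close>.
\<close>

lemma card_ord_eq_le_phi':
  assumes fin: "finite (carrier G)" and le: "card (frob_L G d) \<le> d"
  shows "card {x \<in> carrier G. ord x = d} \<le> phi' d"
proof (cases "{x \<in> carrier G. ord x = d} = {}")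
  case True
  then show ?thesis by (simp only: card.empty)
next
  case False
  then obtain a where a: "a \<in> carrier G" and d: "ord a = d" by blast
  let ?I = "{i. 1 \<le> i \<and> i \<le> d \<and> coprime i d}"
  have "{x \<in> carrier G. ord x = d} \<subseteq> (\<lambda>i::nat. a [^] i) ` ?I"
  proof
    fix x assume x: "x \<in> {x \<in> carrier G. ord x = d}"
    then have "x \<in> frob_L G d" by (auto simp: frob_L_def)
    then obtain i where i: "i \<in> {1..d}" "x = a [^] i"
      using frob_L_eq_powers[OF fin a] le d by auto
    moreover have "coprime i d"
      using pow_ord_eq_ord_iff[OF fin a] x i d by auto
    ultimately show "x \<in> (\<lambda>i::nat. a [^] i) ` ?I" by auto
  qed
  moreover have fI: "finite ?I" by (rule finite_subset[of _ "{..d}"]) auto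
  ultimately have "card {x \<in> carrier G. ord x = d} \<le> card ?I"
    by (rule surj_card_le[rotated])
  then show ?thesis by (simp add: phi'_def)
qed

lemma sum_card_ord_eq:
  assumes fin: "finite (carrier G)"
  shows "(\<Sum>d | d dvd order G. card {x \<in> carrier G. ord x = d}) = order G"
proof -
  have pos: "0 < order G" using fin by (simp add: order_gt_0_iff_finite)
  have "(\<Sum>d | d dvd order G. card {x \<in> carrier G. ord x = d})
      = card (\<Union>d \<in> {d. d dvd order G}. {x \<in> carrier G. ord x = d})"
    using fin pos by (subst card_UN_disjoint) auto
  also have "(\<Union>d \<in> {d. d dvd order G}. {x \<in> carrier G. ord x = d}) = carrier G"
    using ord_dvd_group_order by auto
  finally show ?thesis by (simp add: order_def)
qed

text \<open>
  If no element had order \<open>n\<close>, the term for \<open>d = n\<close> in the count of the elements by their order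
  would be \<open>0 < \<phi>(n)\<close>, and \<open>n\<close> would be less than \<open>\<Sum>d | d dvd n. \<phi>(d) = n\<close>.
\<close>

lemma ex_ord_eq_order:
  assumes fin: "finite (carrier G)"
    and le: "\<And>k. k dvd order G \<Longrightarrow> card (frob_L G k) \<le> k"
  shows "\<exists>a \<in> carrier G. ord a = order G"
proof (rule ccontr)
  assume "\<not> ?thesis"
  then have none: "{x \<in> carrier G. ord x = order G} = {}" by auto
  have pos: "0 < order G" using fin by (simp add: order_gt_0_iff_finite)
  have "(\<Sum>d | d dvd order G. card {x \<in> carrier G. ord x = d})
      < (\<Sum>d | d dvd order G. phi' d)"
  proof (rule sum_strict_mono_ex1)
    show "finite {d. d dvd order G}" using pos by simp
    show "\<forall>d \<in> {d. d dvd order G}. card {x \<in> carrier G. ord x = d} \<le> phi' d"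
      using card_ord_eq_le_phi'[OF fin le] by blast
    have "card {x \<in> carrier G. ord x = order G} < phi' (order G)"
      unfolding none using phi'_nonzero[OF pos] by simp
    then show "\<exists>d \<in> {d. d dvd order G}. card {x \<in> carrier G. ord x = d} < phi' d"
      by (rule bexI[of _ "order G"]) simp
  qed
  then show False
    using sum_card_ord_eq[OF fin] sum_phi'_factors[OF pos] by simp
qed

lemma comm_group_if_ord_eq_order:
  assumes fin: "finite (carrier G)" and a: "a \<in> carrier G" and n: "ord a = order G"
  shows "comm_group G"
proof (rule group_comm_groupI)
  have "(\<lambda>i::nat. a [^] i) ` {1..ord a} = carrier G"
    using card_powers[OF a] n a by (intro card_seteq[OF fin]) (auto simp: order_def)
  then have power: "\<exists>i::nat. x = a [^] i" if "x \<in> carrier G" for x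
    using that by blast
  show "x \<otimes> y = y \<otimes> x" if "x \<in> carrier G" "y \<in> carrier G" for x y
    using power[OF that(1)] power[OF that(2)] a
    by (auto simp: nat_pow_mult add.commute)
qed

lemma card_frob_L_if_ord_eq_order:
  assumes fin: "finite (carrier G)" and a: "a \<in> carrier G" and n: "ord a = order G"
    and k: "k dvd order G" and le: "card (frob_L G k) \<le> k"
  shows "card (frob_L G k) = k"
proof -
  have pos: "0 < order G" using fin by (simp add: order_gt_0_iff_finite)
  then have "order G div k \<noteq> 0" "order G div k dvd order G"
    using k by (auto simp: dvd_div_eq_0_iff)
  then have "ord (a [^] (order G div k)) = order G div (order G div k)"
    using ord_pow[OF a] n by simp
  also have "\<dots> = k" using k pos by (auto elim: dvdE)
  finally have "k \<le> card (frob_L G k)"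
    using ord_le_card_frob_L[OF fin, of "a [^] (order G div k)"] a by simp
  with le show ?thesis by simp
qed

end

lemma (in comm_group) comm_group_imp_solvable: "solvable G"
proof -
  have "h \<otimes> k \<otimes> inv h \<otimes> inv k = \<one>" if "h \<in> carrier G" "k \<in> carrier G" for h k
    using that m_comm[of h k] by (simp add: m_assoc)
  then have "derived_set G (carrier G) = {\<one>}" by auto
  then have "(derived G ^^ 1) (carrier G) = {\<one>}"
    by (simp add: derived_def generate_one)
  then show ?thesis
    using solvable_iff_trivial_derived_seq by blast
qed

theorem theorem2p3:
  fixes G :: "('a, 'b) monoid_scheme"
    and n :: nat
    and g :: "real \<Rightarrow> real \<Rightarrow> nat \<Rightarrow> nat \<Rightarrow> real"
    and r s :: real
  assumes "group G" and "finite (carrier G)" and "order G = n"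
    and "\<And>r' s' k. k dvd n \<Longrightarrow> 0 \<le> g r' s' k (n div k)"
    and "\<And>k. k dvd n \<Longrightarrow>
           1 \<le> g r s k (n div k) \<and>
           frob_f G k \<le> g r s k (n div k) powr (- (1 / 2)) \<and>
           g r s k (n div k) powr (- (1 / 2)) \<le> real k"
  shows "T_fun g G r s = 0 \<and> solvable G"
proof -
  interpret group G by fact
  have pos: "0 < order G" using assms(2) by (simp add: order_gt_0_iff_finite)
  have le: "card (frob_L G k) \<le> k" if k: "k dvd order G" for k
  proof -
    have "0 < k" using k pos by (rule dvd_pos_nat[rotated])
    have g: "1 \<le> g r s k (n div k)" "frob_f G k \<le> g r s k (n div k) powr (- (1 / 2))"
      using assms(3) assms(5)[of k] k by auto
    have "g r s k (n div k) powr (- (1 / 2)) \<le> g r s k (n div k) powr 0"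
      using g(1) by (intro powr_mono) auto
    with g have "frob_f G k \<le> 1" by simp
    with \<open>0 < k\<close> show ?thesis by (simp add: frob_f_def)
  qed
  obtain a where a: "a \<in> carrier G" "ord a = order G"
    using ex_ord_eq_order[OF assms(2) le] by blast
  have "frob_f G k = 1" if "k dvd order G" for k
    using card_frob_L_if_ord_eq_order[OF assms(2) a that le[OF that]] that pos
    by (auto simp: frob_f_def)
  then have "T_fun g G r s = 0" by (simp add: T_fun_def)
  moreover have "solvable G"
    using comm_group.comm_group_imp_solvable[OF comm_group_if_ord_eq_order[OF assms(2) a]] .
  ultimately show ?thesis by blast
qed

end
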